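(* Let $k\ge 2$ be an integer. The function $$f_k(n)=\frac{\log d_k(n)\,\log\log n}{\log k\,\log n},\qquad n\ge 3 \text{ an integer},$$ has a maximum value; that is, there is an integer $N\ge 3$ such that $f_k(n)\le f_k(N)$ for all integers $n\ge 3$.
   Context: For positive integers $k,n$, $d_k(n)$ is the number of ways to write $n$ as an ordered product of $k$ positive integers. *)

theory Defs
  imports Complex_Main
begin

text \<open>Ordered factorizations are lists of length \<open>k\<close> of positive integers. For \<open>n > 0\<close> this
  set is finite, so that \<open>card\<close> is the actual number of its elements.\<close>

definition divisor_fun :: "nat \<Rightarrow> nat \<Rightarrow> nat" where
  "divisor_fun k n = card {xs :: nat list. length xs = k \<and> (\<forall>x\<in>set xs. x > 0) \<and> prod_list xs = n}"

definition norm_log_divisor :: "nat \<Rightarrow> nat \<Rightarrow> real" where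
  "norm_log_divisor k n = (ln (real (divisor_fun k n)) * ln (ln (real n))) / (ln (real k) * ln (real n))"

end

theory Submission
  imports Defs "HOL-Library.FuncSet" "HOL-Computational_Algebra.Primes" "HOL-Real_Asymp.Real_Asymp"
begin

text \<open>
  The limit superior of \<open>f\<^sub>k\<close> is at most 1, while \<open>f\<^sub>k\<close> exceeds 1 at some number, which
  moreover can be chosen independently of \<open>k\<close>. Hence all but finitely many values of \<open>f\<^sub>k\<close> lie
  below that one value, and the supremum is the maximum of a finite set.

  Both halves rest on one observation: multiplying \<open>m\<close> by a prime \<open>p\<close> means choosing which of the \<open>k\<close>
  factors absorbs \<open>p\<close>. Every ordered factorization of \<open>p m\<close> arises in this way, so
  \<open>d\<^sub>k(p m) \<le> k d\<^sub>k(m)\<close>, and if \<open>p\<close> does not divide \<open>m\<close> then the choice can be read off, so that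
  equality holds (\<open>divisor_fun_prime_mult_le\<close>, \<open>divisor_fun_prime_mult\<close>).

  For the value above 1, equality gives \<open>d\<^sub>k(n) = k ^ r\<close> for a product \<open>n\<close> of \<open>r\<close> distinct primes. Then
  \<open>f\<^sub>k(n) = r log log n / log n\<close> does not depend on \<open>k\<close>, and \<open>n = 2 \<sqdot> 3 \<sqdot> 5 \<sqdot> 7\<close> is large enough.

  For the limit superior, fix \<open>\<delta> > 0\<close> and let \<open>Y\<close> be about \<open>k powr (1 / \<delta>)\<close>. Each prime factor \<open>p \<ge> Y\<close>
  multiplies \<open>d\<^sub>k\<close> by at most \<open>k \<le> p powr \<delta>\<close>, so these primes contribute at most \<open>n powr \<delta>\<close> altogether. What
  remains has only prime factors below \<open>Y\<close>, hence at most \<open>L ^ Y\<close> divisors with \<open>L\<close> of order \<open>log n\<close>, and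
  at most \<open>L ^ (Y k)\<close> ordered factorizations. The choice \<open>\<delta> = a log k / log log n\<close> with \<open>a > 1\<close> makes
  \<open>Y\<close> about \<open>(log n) powr (1 / a)\<close>; then \<open>Y k log L\<close> is negligible against \<open>\<delta> log n\<close>, and
  \<open>f\<^sub>k(n) \<le> a + o(1)\<close> (\<open>divisor_fun_le_powr\<close>, \<open>eventually_norm_log_divisor_less\<close>).
\<close>

section \<open>Ordered factorizations and one additional prime factor\<close>

definition ordered_factorizations :: "nat \<Rightarrow> nat \<Rightarrow> nat list set" where
  "ordered_factorizations k n = {xs. length xs = k \<and> (\<forall>x\<in>set xs. x > 0) \<and> prod_list xs = n}"

lemma divisor_fun_eq_card: "divisor_fun k n = card (ordered_factorizations k n)"
  by (simp add: divisor_fun_def ordered_factorizations_def)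

lemma ordered_factorizations_subset_lists:
  "ordered_factorizations k n \<subseteq> {xs. set xs \<subseteq> {d. d dvd n} \<and> length xs = k}"
  by (auto simp: ordered_factorizations_def dest: prod_list_dvd)

lemma finite_ordered_factorizations:
  assumes "n > 0"
  shows "finite (ordered_factorizations k n)"
  using finite_subset[OF ordered_factorizations_subset_lists]
    finite_lists_length_eq[OF finite_divisors_nat[OF assms]] by blast

lemma divisor_fun_le_power_card_divisors:
  assumes "n > 0"
  shows "divisor_fun k n \<le> card {d. d dvd n} ^ k"
proof -
  have fin: "finite {d. d dvd n}" using assms by (rule finite_divisors_nat)
  show ?thesis
    unfolding divisor_fun_eq_card card_lists_length_eq[OF fin, symmetric]
    by (intro card_mono finite_lists_length_eq fin ordered_factorizations_subset_lists)
qed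

text \<open>The pair \<open>(i, xs)\<close> encodes a factorization of \<open>m\<close> together with the position that absorbs the
  additional prime \<open>p\<close>.\<close>

definition multiply_entry :: "nat \<Rightarrow> nat \<times> nat list \<Rightarrow> nat list" where
  "multiply_entry p = (\<lambda>(i, xs). xs[i := p * xs ! i])"

lemma prod_list_multiply_entry:
  fixes xs :: "nat list"
  assumes "i < length xs"
  shows "prod_list (xs[i := p * xs ! i]) = p * prod_list xs"
  using assms
proof (induction xs arbitrary: i)
  case (Cons x xs)
  then show ?case by (cases i) auto
qed simp

text \<open>Surjectivity is where primality enters: a prime dividing a product divides one of the entries,
  and dividing that entry by \<open>p\<close> gives a preimage. It need not be unique, since \<open>p\<close> may divide several
  entries.\<close>

lemma multiply_entry_image:
  assumes "prime p"
  shows "multiply_entry p ` ({..<k} \<times> ordered_factorizations k m) = ordered_factorizations k (p * m)"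
proof (intro equalityI subsetI)
  fix ys assume "ys \<in> multiply_entry p ` ({..<k} \<times> ordered_factorizations k m)"
  then obtain i xs where i: "i < k" and xs: "xs \<in> ordered_factorizations k m"
    and ys: "ys = xs[i := p * xs ! i]"
    by (auto simp: multiply_entry_def)
  have "p * xs ! i > 0"
    using xs i prime_gt_0_nat[OF assms] by (auto simp: ordered_factorizations_def)
  moreover have "set ys \<subseteq> insert (p * xs ! i) (set xs)"
    unfolding ys by (rule set_update_subset_insert)
  ultimately show "ys \<in> ordered_factorizations k (p * m)"
    using xs i by (auto simp: ordered_factorizations_def ys prod_list_multiply_entry)
next
  fix ys assume ys: "ys \<in> ordered_factorizations k (p * m)"
  then have "p dvd prod_list ys" by (simp add: ordered_factorizations_def)
  then obtain y where "y \<in> set ys" "p dvd y"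
    using prime_dvd_prod_mset_iff[OF assms, of "mset ys"] by (auto simp: prod_mset_prod_list)
  then obtain i where i: "i < k" and "p dvd ys ! i"
    using ys by (auto simp: ordered_factorizations_def in_set_conv_nth)
  then obtain z where z: "ys ! i = p * z" by blast
  define xs where "xs = ys[i := z]"
  have len: "i < length xs" "length xs = k" using ys i by (auto simp: xs_def ordered_factorizations_def)
  have "xs ! i = z" using len by (simp add: xs_def)
  then have ys_eq: "ys = xs[i := p * xs ! i]"
    by (simp add: xs_def flip: z)
  have "z > 0" using ys i z by (force simp: ordered_factorizations_def in_set_conv_nth)
  moreover have "set xs \<subseteq> insert z (set ys)"
    unfolding xs_def by (rule set_update_subset_insert)
  moreover have "p * prod_list xs = p * m"
    using ys len by (simp add: ys_eq prod_list_multiply_entry ordered_factorizations_def)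
  ultimately have "xs \<in> ordered_factorizations k m"
    using ys len prime_gt_0_nat[OF assms] by (auto simp: ordered_factorizations_def)
  then show "ys \<in> multiply_entry p ` ({..<k} \<times> ordered_factorizations k m)"
    using i ys_eq by (auto simp: multiply_entry_def intro!: image_eqI[of _ _ "(i, xs)"])
qed

lemma divisor_fun_prime_mult_le:
  assumes "prime p" "m > 0"
  shows "divisor_fun k (p * m) \<le> k * divisor_fun k m"
proof -
  have "card (ordered_factorizations k (p * m)) \<le> card ({..<k} \<times> ordered_factorizations k m)"
    unfolding multiply_entry_image[OF assms(1), symmetric]
    by (intro card_image_le finite_cartesian_product finite_ordered_factorizations assms finite_lessThan)
  then show ?thesis by (simp add: divisor_fun_eq_card card_cartesian_product)
qed

text \<open>If \<open>p\<close> does not divide \<open>m\<close>, it divides no entry of a factorization of \<open>m\<close>, so the entry that absorbed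
  \<open>p\<close> is the only one divisible by \<open>p\<close>.\<close>

lemma inj_on_multiply_entry:
  assumes "prime p" "\<not> p dvd m"
  shows "inj_on (multiply_entry p) ({..<k} \<times> ordered_factorizations k m)"
proof (rule inj_onI)
  have index: "j = i"
    if "xs \<in> ordered_factorizations k m" "i < k" "j < k" "p dvd xs[i := p * xs ! i] ! j" for i j xs
  proof (rule ccontr)
    assume "j \<noteq> i"
    with that have "p dvd xs ! j" by simp
    also have "xs ! j dvd prod_list xs"
      using that by (intro prod_list_dvd) (auto simp: ordered_factorizations_def)
    finally show False using that assms by (simp add: ordered_factorizations_def)
  qed
  fix a b assume a: "a \<in> {..<k} \<times> ordered_factorizations k m"
    and b: "b \<in> {..<k} \<times> ordered_factorizations k m"
    and eq: "multiply_entry p a = multiply_entry p b"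
  obtain i xs j ys where ab: "a = (i, xs)" "b = (j, ys)" by (cases a, cases b)
  have eq': "xs[i := p * xs ! i] = ys[j := p * ys ! j]"
    using eq by (simp add: ab multiply_entry_def)
  have len: "length xs = k" "length ys = k" "i < k" "j < k"
    using a b by (auto simp: ab ordered_factorizations_def)
  have "i = j"
    using index[of ys j i] b len unfolding ab by (simp flip: eq')
  have "xs ! l = ys ! l" if "l < k" for l
    using arg_cong[OF eq', of "\<lambda>zs. zs ! l"] that len \<open>i = j\<close> prime_gt_0_nat[OF assms(1)]
    by (cases "l = i") auto
  then have "xs = ys" using len by (auto intro: nth_equalityI)
  with \<open>i = j\<close> show "a = b" by (simp add: ab)
qed

lemma divisor_fun_prime_mult:
  assumes "prime p" "\<not> p dvd m"
  shows "divisor_fun k (p * m) = k * divisor_fun k m"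
  using card_image[OF inj_on_multiply_entry[OF assms, of k]]
  by (simp add: divisor_fun_eq_card card_cartesian_product multiply_entry_image[OF assms(1)])

lemma divisor_fun_1: "divisor_fun k 1 = 1"
proof -
  have "ordered_factorizations k 1 = {replicate k 1}"
  proof (intro equalityI subsetI)
    fix xs assume xs: "xs \<in> ordered_factorizations k 1"
    then have "x = 1" if "x \<in> set xs" for x
      using prod_list_dvd[OF that] by (simp add: ordered_factorizations_def)
    then show "xs \<in> {replicate k 1}"
      using xs by (auto simp: ordered_factorizations_def intro: replicate_eqI)
  qed (auto simp: ordered_factorizations_def)
  then show ?thesis by (simp add: divisor_fun_eq_card)
qed

lemma divisor_fun_pos:
  assumes "n > 0" "k > 0"
  shows "divisor_fun k n > 0"
proof -
  have "n # replicate (k - 1) 1 \<in> ordered_factorizations k n"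
    using assms by (auto simp: ordered_factorizations_def)
  then show ?thesis
    using finite_ordered_factorizations[OF assms(1)]
    by (auto simp: divisor_fun_eq_card card_gt_0_iff)
qed

section \<open>Upper bounds\<close>

text \<open>A divisor is determined by its exponents at the primes below \<open>Y\<close>, at most \<open>Y\<close> in number, and each exponent
  is below \<open>L\<close> because \<open>2 ^ e \<le> p ^ e \<le> n < 2 ^ L\<close>.\<close>

lemma card_divisors_smooth_le:
  assumes "n > 0" "n < 2 ^ L" and smooth: "\<And>p. prime p \<Longrightarrow> p dvd n \<Longrightarrow> p < Y"
  shows "card {d. d dvd n} \<le> L ^ Y"
proof -
  define expo where "expo d = (\<lambda>p\<in>{..<Y}. if prime p then multiplicity p d else 0)" for d :: nat
  have "L > 0" using assms by (cases L) auto
  have bound: "multiplicity p d < L" if "d dvd n" "prime p" for p d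
  proof -
    have "2 ^ multiplicity p d \<le> p ^ multiplicity p d"
      using prime_ge_2_nat[OF that(2)] by (rule power_mono) simp
    also have "\<dots> \<le> n"
      using multiplicity_dvd[of p d] that assms(1) by (meson dvd_imp_le dvd_trans)
    also have "\<dots> < 2 ^ L" by fact
    finally show ?thesis by simp
  qed
  have maps: "expo ` {d. d dvd n} \<subseteq> {..<Y} \<rightarrow>\<^sub>E {..<L}"
    using bound \<open>L > 0\<close> unfolding expo_def
    by (intro image_subsetI restrict_PiE) auto
  have inj: "inj_on expo {d. d dvd n}"
  proof (rule inj_onI)
    fix d e assume de: "d \<in> {d. d dvd n}" "e \<in> {d. d dvd n}" and eq: "expo d = expo e"
    have pos: "d > 0" "e > 0" using de assms(1) by (auto intro: dvd_pos_nat)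
    show "d = e"
    proof (rule multiplicity_eq_nat[OF pos])
      fix p :: nat assume p: "prime p"
      show "multiplicity p d = multiplicity p e"
      proof (cases "p < Y")
        case True
        then show ?thesis using fun_cong[OF eq, of p] p by (simp add: expo_def)
      next
        case False
        then have "\<not> p dvd d" "\<not> p dvd e" using smooth[OF p] de by (auto dest: dvd_trans)
        then show ?thesis by (simp add: not_dvd_imp_multiplicity_0)
      qed
    qed
  qed
  have "card {d. d dvd n} \<le> card ({..<Y} \<rightarrow>\<^sub>E {..<L})"
    using inj maps by (rule card_inj_on_le) (simp add: finite_PiE)
  then show ?thesis by (simp add: card_PiE)
qed

text \<open>Prime factors \<open>p \<ge> Y\<close> are split off one at a time: each multiplies \<open>d\<^sub>k\<close> by at most
  \<open>k \<le> p powr \<delta>\<close>, which is exactly the growth of \<open>n powr \<delta>\<close>. Since \<open>L\<close> only has to satisfy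
  \<open>n < 2 ^ L\<close>, the second factor stays the same throughout this descent, which ends at a number
  whose prime factors are all below \<open>Y\<close>.\<close>

lemma divisor_fun_le_powr:
  assumes "k > 0" "\<delta> > 0" "real k \<le> real Y powr \<delta>"
  shows "n > 0 \<Longrightarrow> n < 2 ^ L \<Longrightarrow> real (divisor_fun k n) \<le> real n powr \<delta> * real L ^ (Y * k)"
proof (induction n rule: less_induct)
  case (less n)
  show ?case
  proof (cases "\<forall>p. prime p \<longrightarrow> p dvd n \<longrightarrow> p < Y")
    case True
    have "divisor_fun k n \<le> card {d. d dvd n} ^ k"
      using less.prems(1) by (rule divisor_fun_le_power_card_divisors)
    also have "\<dots> \<le> (L ^ Y) ^ k"
      using less.prems True by (intro power_mono card_divisors_smooth_le) auto
    finally have "real (divisor_fun k n) \<le> 1 * real L ^ (Y * k)"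
      by (simp add: power_mult flip: of_nat_power)
    also have "\<dots> \<le> real n powr \<delta> * real L ^ (Y * k)"
      using less.prems assms(2) by (intro mult_right_mono) (auto simp: ge_one_powr_ge_zero)
    finally show ?thesis .
  next
    case False
    then obtain p m where p: "prime p" "p \<ge> Y" and n: "n = p * m" by (auto simp: not_less)
    have m: "m > 0" "m < n"
      using less.prems(1) prime_gt_1_nat[OF p(1)] by (auto simp: n)
    have "real (divisor_fun k n) \<le> real k * real (divisor_fun k m)"
      using divisor_fun_prime_mult_le[OF p(1) m(1), of k] unfolding n
      by (simp flip: of_nat_mult)
    also have "\<dots> \<le> real p powr \<delta> * (real m powr \<delta> * real L ^ (Y * k))"
    proof (rule mult_mono)
      show "real k \<le> real p powr \<delta>"
        using assms(3) powr_mono2[of \<delta> "real Y" "real p"] assms(2) p(2) by simp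
      show "real (divisor_fun k m) \<le> real m powr \<delta> * real L ^ (Y * k)"
        using less.IH[OF m(2,1)] less.prems m by linarith
    qed auto
    also have "\<dots> = real n powr \<delta> * real L ^ (Y * k)"
      by (simp add: n powr_mult)
    finally show ?thesis .
  qed
qed

text \<open>With \<open>x = ln n\<close>, the term \<open>\<delta> x\<close> contributes the constant \<open>a\<close> to the normalized logarithm, and
  the small primes contribute \<open>err x\<close>. Taking \<open>a\<close> strictly between 1 and \<open>c\<close> makes the exponent
  \<open>b = 1 / a\<close> of \<open>x\<close> less than 1, which is what makes \<open>err\<close> vanish, and leaves room for it below \<open>c\<close>.\<close>

lemma eventually_norm_log_divisor_less:
  fixes c :: real
  assumes "k \<ge> 2" "c > 1"
  shows "\<forall>\<^sub>F n in sequentially. norm_log_divisor k n < c"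
proof -
  define a where "a = (1 + c) / 2"
  have a: "1 < a" "a < c" using assms by (auto simp: a_def)
  have lnk: "ln (real k) > 0" using assms by simp
  define b where "b = 1 / a"
  have b: "0 < b" "b < 1" using a by (auto simp: b_def)
  define err where
    "err x = real k / ln (real k) * ((x powr b + 1) * ln (2 * x + 2) * ln x / x)" for x
  have "((\<lambda>x. (x powr b + 1) * ln (2 * x + 2) * ln x / x) \<longlongrightarrow> 0) at_top"
    using b by real_asymp
  then have "(err \<longlongrightarrow> 0) at_top" unfolding err_def by (rule tendsto_mult_right_zero)
  then have "\<forall>\<^sub>F x in at_top. err x < c - a \<and> x > 1"
    using a by (intro eventually_conj order_tendstoD(2) eventually_gt_at_top) auto
  moreover have "filterlim (\<lambda>n. ln (real n)) at_top sequentially"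
    by real_asymp
  ultimately have "\<forall>\<^sub>F n in sequentially. err (ln (real n)) < c - a \<and> ln (real n) > 1"
    by (rule eventually_compose_filterlim)
  then show ?thesis
  proof (eventually_elim)
    case (elim n)
    define x where "x = ln (real n)"
    have x: "x > 1" "err x < c - a" using elim by (auto simp: x_def)
    have n: "n > 0" using x by (cases n) (auto simp: x_def)
    have lnx: "ln x > 0" using x by simp
    define \<delta> where "\<delta> = a * ln (real k) / ln x"
    define Y where "Y = nat \<lceil>x powr b\<rceil>"
    define L where "L = nat \<lceil>2 * x\<rceil> + 1"
    have Y: "x powr b \<le> real Y" "real Y \<le> x powr b + 1"
      using powr_ge_zero[of x b] unfolding Y_def by linarith+
    have L: "2 * x < real L" "real L \<le> 2 * x + 2" using x unfolding L_def by linarith+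
    have \<delta>: "\<delta> > 0" using a lnk lnx by (simp add: \<delta>_def)
    \<comment> \<open>The choice of \<open>\<delta>\<close> amounts to \<open>b * \<delta> = ln k / ln x\<close>, so that \<open>x powr b\<close> is the threshold
      at which \<open>p powr \<delta>\<close> reaches \<open>k\<close>.\<close>
    have "real k = x powr (b * \<delta>)"
      using x lnx a assms by (simp add: powr_def \<delta>_def b_def)
    also have "\<dots> = (x powr b) powr \<delta>" by (simp add: powr_powr)
    also have "\<dots> \<le> real Y powr \<delta>" using Y \<delta> by (intro powr_mono2) auto
    finally have kY: "real k \<le> real Y powr \<delta>" .
    have "real n = exp x" using n by (simp add: x_def)
    also have "exp x < exp (real L * ln 2)"
    proof -
      have "exp 1 < exp (ln ((2 :: real) ^ 2))" using exp_le by simp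
      then have "1 < ln ((2 :: real) ^ 2)" by (simp only: exp_less_cancel_iff)
      then have "1 / 2 < ln (2 :: real)" by (subst (asm) ln_realpow) auto
      then have "x < 2 * x * ln 2" using x by (simp add: field_simps)
      also have "\<dots> < real L * ln 2" using L by (intro mult_strict_right_mono) auto
      finally show ?thesis by simp
    qed
    also have "\<dots> = real (2 ^ L)" by (simp add: exp_of_nat_mult)
    finally have nL: "n < 2 ^ L" by (simp only: of_nat_less_iff)
    have Lpos: "real L > 0" using L x by linarith
    have "real (divisor_fun k n) \<le> real n powr \<delta> * real L ^ (Y * k)"
      using assms \<delta> kY n nL by (intro divisor_fun_le_powr) auto
    then have "ln (real (divisor_fun k n)) \<le> ln (real n powr \<delta> * real L ^ (Y * k))"
      using divisor_fun_pos[OF n, of k] assms n Lpos by (intro ln_mono) auto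
    also have "\<dots> = \<delta> * x + real Y * real k * ln (real L)"
      using n Lpos by (simp add: ln_mult ln_powr ln_realpow x_def)
    also have "\<dots> \<le> \<delta> * x + (x powr b + 1) * real k * ln (2 * x + 2)"
      using Y L Lpos x by (intro add_left_mono mult_mono ln_mono) auto
    finally have "norm_log_divisor k n
        \<le> (\<delta> * x + (x powr b + 1) * real k * ln (2 * x + 2)) * ln x / (ln (real k) * x)"
      using lnx lnk x unfolding norm_log_divisor_def x_def[symmetric]
      by (intro divide_right_mono mult_right_mono) auto
    also have "\<dots> = a + err x"
      using lnx lnk x by (simp add: \<delta>_def err_def field_simps)
    also have "\<dots> < c" using x by simp
    finally show ?case .
  qed
qed

section \<open>A value above the limit superior\<close>

text \<open>The claim amounts to \<open>210 < (ln 210) ^ 4\<close>, and the number 210 leaves enough room for the crude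
  bound \<open>exp 1 \<le> 3\<close>: from \<open>exp 4 \<le> 3 ^ 4 < 210\<close> one gets \<open>ln 210 > 4\<close>, while \<open>210 < 4 ^ 4\<close>.\<close>

lemma norm_log_divisor_210_gt_1:
  assumes "k \<ge> 2"
  shows "norm_log_divisor k 210 > 1"
proof -
  have "divisor_fun k 2 = k" "divisor_fun k 6 = k * k" "divisor_fun k 30 = k * (k * k)"
    "divisor_fun k 210 = k * (k * (k * k))"
    using divisor_fun_prime_mult[of 2 1 k] divisor_fun_prime_mult[of 3 2 k]
      divisor_fun_prime_mult[of 5 6 k] divisor_fun_prime_mult[of 7 30 k] divisor_fun_1[of k]
    by simp_all
  then have "divisor_fun k 210 = k ^ 4" by (simp add: eval_nat_numeral)
  then have eq: "norm_log_divisor k 210 = 4 * ln (ln 210) / ln 210"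
    using assms by (simp add: norm_log_divisor_def ln_realpow)
  have "exp (4 :: real) = exp 1 ^ 4" by (simp flip: exp_of_nat_mult)
  also have "\<dots> \<le> 3 ^ 4" using exp_le by (intro power_mono) auto
  also have "\<dots> < exp (ln (210 :: real))" by simp
  finally have t: "4 < ln (210 :: real)" by (simp only: exp_less_cancel_iff)
  have "(210 :: real) < 4 ^ 4" by simp
  also have "\<dots> < ln 210 ^ 4" using t by (intro power_strict_mono) auto
  finally have "ln 210 < ln (ln (210 :: real) ^ 4)" by (subst ln_less_cancel_iff) auto
  also have "\<dots> = 4 * ln (ln 210)" using t by (simp add: ln_realpow)
  finally show ?thesis using t by (simp add: eq field_simps)
qed

theorem theorem4p5:
  fixes k :: nat
  assumes "k \<ge> 2"
  shows "\<exists>N::nat. N \<ge> 3 \<and> (\<forall>n::nat. n \<ge> 3 \<longrightarrow> norm_log_divisor k n \<le> norm_log_divisor k N)"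
proof -
  let ?f = "norm_log_divisor k"
  obtain M where M: "\<And>n. n \<ge> M \<Longrightarrow> ?f n < ?f 210"
    using eventually_norm_log_divisor_less[OF assms norm_log_divisor_210_gt_1[OF assms]]
    by (auto simp: eventually_sequentially)
  define S where "S = insert 210 {3..<M}"
  have S: "finite (?f ` S)" "?f ` S \<noteq> {}" by (auto simp: S_def)
  obtain N where N: "N \<in> S" "?f N = Max (?f ` S)" using Max_in[OF S] by auto
  have max: "?f n \<le> ?f N" if "n \<in> S" for n using Max_ge[OF S(1)] that N(2) by auto
  have "?f n \<le> ?f N" if "n \<ge> 3" for n
  proof (cases "n < M")
    case True
    then show ?thesis using that by (intro max) (auto simp: S_def)
  next
    case False
    then have "?f n < ?f 210" using M by simp
    also have "\<dots> \<le> ?f N" by (intro max) (simp add: S_def)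
    finally show ?thesis by simp
  qed
  moreover have "N \<ge> 3" using N(1) by (auto simp: S_def)
  ultimately show ?thesis by blast
qed

end
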